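(* Let $\mathcal{T}$ be a theory over a one-sorted first-order signature $\Sigma$. If $\mathcal{T}$ is gentle, then for every $\mathcal{T}$-satisfiable quantifier-free $\Sigma$-formula $\phi$, $\mu(\mathcal{T},\phi)$ is well-defined and equal to $0$ or $1$.
   Context: Interpretations have non-empty domains and assign values to all variables; a theory is the class of all interpretations satisfying a given set of sentences. $\mathrm{Spec}(\mathcal{T},\phi)$ is the set of finite cardinalities of domains of $\mathcal{T}$-interpretations satisfying $\phi$; $\mu(\mathcal{T},\phi)=\lim_{n\to\infty}|\mathrm{Spec}(\mathcal{T},\phi)\cap\{1,\dots,n\}|/n$ when the limit exists. $\mathcal{T}$ is gentle if for every quantifier-free formula $\phi$: (i) $\mathrm{Spec}(\mathcal{T},\phi)$ is computable; (ii) it is either co-finite in $\mathbb{N}$ or finite, and an algorithm with input $\phi$ decides which; (iii) if finite, its maximum is computable from $\phi$, and if infinite, $\max(\mathbb{N}\setminus\mathrm{Spec}(\mathcal{T},\phi))$ is computable from $\phi$ (the maximum of the empty set being $0$). *)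

theory Defs
  imports Complex_Main "HOL-Library.Nat_Bijection" "HOL-Library.Infinite_Typeclass"
begin

section \<open>One-sorted first-order logic with equality\<close>

record ('f, 'p) signature =
  funs :: "'f set"
  farity :: "'f \<Rightarrow> nat"
  preds :: "'p set"
  parity :: "'p \<Rightarrow> nat"

datatype 'f trm = Var nat | App 'f "'f trm list"

datatype ('f, 'p) form =
    Eq "'f trm" "'f trm"
  | Pred 'p "'f trm list"
  | Neg "('f, 'p) form"
  | Conj "('f, 'p) form" "('f, 'p) form"
  | Disj "('f, 'p) form" "('f, 'p) form"
  | Imp "('f, 'p) form" "('f, 'p) form"
  | All nat "('f, 'p) form"
  | Ex nat "('f, 'p) form"

fun trm_over :: "('f, 'p) signature \<Rightarrow> 'f trm \<Rightarrow> bool" where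
  "trm_over \<Sigma> (Var x) \<longleftrightarrow> True"
| "trm_over \<Sigma> (App f ts) \<longleftrightarrow>
     f \<in> funs \<Sigma> \<and> length ts = farity \<Sigma> f \<and> (\<forall>t \<in> set ts. trm_over \<Sigma> t)"

fun form_over :: "('f, 'p) signature \<Rightarrow> ('f, 'p) form \<Rightarrow> bool" where
  "form_over \<Sigma> (Eq s t) \<longleftrightarrow> trm_over \<Sigma> s \<and> trm_over \<Sigma> t"
| "form_over \<Sigma> (Pred p ts) \<longleftrightarrow>
     p \<in> preds \<Sigma> \<and> length ts = parity \<Sigma> p \<and> (\<forall>t \<in> set ts. trm_over \<Sigma> t)"
| "form_over \<Sigma> (Neg \<phi>) \<longleftrightarrow> form_over \<Sigma> \<phi>"
| "form_over \<Sigma> (Conj \<phi> \<psi>) \<longleftrightarrow> form_over \<Sigma> \<phi> \<and> form_over \<Sigma> \<psi>"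
| "form_over \<Sigma> (Disj \<phi> \<psi>) \<longleftrightarrow> form_over \<Sigma> \<phi> \<and> form_over \<Sigma> \<psi>"
| "form_over \<Sigma> (Imp \<phi> \<psi>) \<longleftrightarrow> form_over \<Sigma> \<phi> \<and> form_over \<Sigma> \<psi>"
| "form_over \<Sigma> (All x \<phi>) \<longleftrightarrow> form_over \<Sigma> \<phi>"
| "form_over \<Sigma> (Ex x \<phi>) \<longleftrightarrow> form_over \<Sigma> \<phi>"

fun fv_trm :: "'f trm \<Rightarrow> nat set" where
  "fv_trm (Var x) = {x}"
| "fv_trm (App f ts) = (\<Union>t \<in> set ts. fv_trm t)"

fun fv :: "('f, 'p) form \<Rightarrow> nat set" where
  "fv (Eq s t) = fv_trm s \<union> fv_trm t"
| "fv (Pred p ts) = (\<Union>t \<in> set ts. fv_trm t)"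
| "fv (Neg \<phi>) = fv \<phi>"
| "fv (Conj \<phi> \<psi>) = fv \<phi> \<union> fv \<psi>"
| "fv (Disj \<phi> \<psi>) = fv \<phi> \<union> fv \<psi>"
| "fv (Imp \<phi> \<psi>) = fv \<phi> \<union> fv \<psi>"
| "fv (All x \<phi>) = fv \<phi> - {x}"
| "fv (Ex x \<phi>) = fv \<phi> - {x}"

fun quantifier_free :: "('f, 'p) form \<Rightarrow> bool" where
  "quantifier_free (Eq s t) \<longleftrightarrow> True"
| "quantifier_free (Pred p ts) \<longleftrightarrow> True"
| "quantifier_free (Neg \<phi>) \<longleftrightarrow> quantifier_free \<phi>"
| "quantifier_free (Conj \<phi> \<psi>) \<longleftrightarrow> quantifier_free \<phi> \<and> quantifier_free \<psi>"
| "quantifier_free (Disj \<phi> \<psi>) \<longleftrightarrow> quantifier_free \<phi> \<and> quantifier_free \<psi>"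
| "quantifier_free (Imp \<phi> \<psi>) \<longleftrightarrow> quantifier_free \<phi> \<and> quantifier_free \<psi>"
| "quantifier_free (All x \<phi>) \<longleftrightarrow> False"
| "quantifier_free (Ex x \<phi>) \<longleftrightarrow> False"

definition sentence :: "('f, 'p) signature \<Rightarrow> ('f, 'p) form \<Rightarrow> bool" where
  "sentence \<Sigma> \<phi> \<longleftrightarrow> form_over \<Sigma> \<phi> \<and> fv \<phi> = {}"

definition qf_forms :: "('f, 'p) signature \<Rightarrow> ('f, 'p) form set" where
  "qf_forms \<Sigma> = {\<phi>. form_over \<Sigma> \<phi> \<and> quantifier_free \<phi>}"

text \<open>
  Domains are arbitrary non-empty subsets of a universe type. The universe is required to be
  infinite so that every finite cardinality is available as the size of a domain.
\<close>

record ('f, 'p, 'u :: infinite) interp =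
  dom :: "'u set"
  fint :: "'f \<Rightarrow> 'u list \<Rightarrow> 'u"
  pint :: "'p \<Rightarrow> 'u list \<Rightarrow> bool"
  asg :: "nat \<Rightarrow> 'u"

definition interpretation_of ::
    "('f, 'p) signature \<Rightarrow> ('f, 'p, 'u :: infinite) interp \<Rightarrow> bool" where
  "interpretation_of \<Sigma> I \<longleftrightarrow>
     dom I \<noteq> {} \<and>
     (\<forall>f \<in> funs \<Sigma>. \<forall>us. length us = farity \<Sigma> f \<and> set us \<subseteq> dom I \<longrightarrow> fint I f us \<in> dom I) \<and>
     (\<forall>x. asg I x \<in> dom I)"

fun eval_trm :: "('f, 'p, 'u :: infinite) interp \<Rightarrow> 'f trm \<Rightarrow> 'u" where
  "eval_trm I (Var x) = asg I x"
| "eval_trm I (App f ts) = fint I f (map (eval_trm I) ts)"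

fun sat :: "('f, 'p, 'u :: infinite) interp \<Rightarrow> ('f, 'p) form \<Rightarrow> bool" where
  "sat I (Eq s t) \<longleftrightarrow> eval_trm I s = eval_trm I t"
| "sat I (Pred p ts) \<longleftrightarrow> pint I p (map (eval_trm I) ts)"
| "sat I (Neg \<phi>) \<longleftrightarrow> \<not> sat I \<phi>"
| "sat I (Conj \<phi> \<psi>) \<longleftrightarrow> sat I \<phi> \<and> sat I \<psi>"
| "sat I (Disj \<phi> \<psi>) \<longleftrightarrow> sat I \<phi> \<or> sat I \<psi>"
| "sat I (Imp \<phi> \<psi>) \<longleftrightarrow> (sat I \<phi> \<longrightarrow> sat I \<psi>)"
| "sat I (All x \<phi>) \<longleftrightarrow> (\<forall>u \<in> dom I. sat (I\<lparr>asg := (asg I)(x := u)\<rparr>) \<phi>)"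
| "sat I (Ex x \<phi>) \<longleftrightarrow> (\<exists>u \<in> dom I. sat (I\<lparr>asg := (asg I)(x := u)\<rparr>) \<phi>)"

definition is_theory ::
    "('f, 'p) signature \<Rightarrow> ('f, 'p, 'u :: infinite) interp set \<Rightarrow> bool" where
  "is_theory \<Sigma> T \<longleftrightarrow>
     (\<exists>Ax. (\<forall>\<alpha> \<in> Ax. sentence \<Sigma> \<alpha>) \<and>
           T = {I. interpretation_of \<Sigma> I \<and> (\<forall>\<alpha> \<in> Ax. sat I \<alpha>)})"

definition satisfiable_in ::
    "('f, 'p, 'u :: infinite) interp set \<Rightarrow> ('f, 'p) form \<Rightarrow> bool" where
  "satisfiable_in T \<phi> \<longleftrightarrow> (\<exists>I \<in> T. sat I \<phi>)"


section \<open>Spectra and their density\<close>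

definition Spec :: "('f, 'p, 'u :: infinite) interp set \<Rightarrow> ('f, 'p) form \<Rightarrow> nat set" where
  "Spec T \<phi> = {card (dom I) | I. I \<in> T \<and> finite (dom I) \<and> sat I \<phi>}"

definition Spec_ratio ::
    "('f, 'p, 'u :: infinite) interp set \<Rightarrow> ('f, 'p) form \<Rightarrow> nat \<Rightarrow> real" where
  "Spec_ratio T \<phi> n = real (card (Spec T \<phi> \<inter> {1..n})) / real n"

definition mu :: "('f, 'p, 'u :: infinite) interp set \<Rightarrow> ('f, 'p) form \<Rightarrow> real" where
  "mu T \<phi> = lim (Spec_ratio T \<phi>)"

definition mu_well_defined ::
    "('f, 'p, 'u :: infinite) interp set \<Rightarrow> ('f, 'p) form \<Rightarrow> bool" where
  "mu_well_defined T \<phi> \<longleftrightarrow> convergent (Spec_ratio T \<phi>)"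


section \<open>Computability\<close>

text \<open>
  Kleene's partial recursive functions: programs with a big-step semantics, where
  \<open>evaluates p xs y\<close> says that \<open>p\<close> halts on the arguments \<open>xs\<close> with output \<open>y\<close>.
\<close>

datatype recf = Zero | Succ | Proj nat | Comp recf "recf list" | Prec recf recf | Mn recf

inductive evaluates :: "recf \<Rightarrow> nat list \<Rightarrow> nat \<Rightarrow> bool" where
  Zero: "evaluates Zero xs 0"
| Succ: "evaluates Succ [x] (Suc x)"
| Proj: "i < length xs \<Longrightarrow> evaluates (Proj i) xs (xs ! i)"
| Comp: "list_all2 (\<lambda>q z. evaluates q xs z) qs zs \<Longrightarrow> evaluates p zs y \<Longrightarrow>
         evaluates (Comp p qs) xs y"
| Prec_0: "evaluates p xs y \<Longrightarrow> evaluates (Prec p q) (0 # xs) y"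
| Prec_Suc: "evaluates (Prec p q) (n # xs) z \<Longrightarrow> evaluates q (n # z # xs) y \<Longrightarrow>
             evaluates (Prec p q) (Suc n # xs) y"
| Mn: "evaluates p (n # xs) 0 \<Longrightarrow> \<forall>m < n. \<exists>k > 0. evaluates p (m # xs) k \<Longrightarrow>
       evaluates (Mn p) xs n"

inductive_cases evaluates_ZeroE: "evaluates Zero xs y"
inductive_cases evaluates_SuccE: "evaluates Succ xs y"
inductive_cases evaluates_ProjE: "evaluates (Proj i) xs y"
inductive_cases evaluates_CompE: "evaluates (Comp p qs) xs y"
inductive_cases evaluates_Prec_0E: "evaluates (Prec p q) (0 # xs) y"
inductive_cases evaluates_Prec_SucE: "evaluates (Prec p q) (Suc n # xs) y"
inductive_cases evaluates_MnE: "evaluates (Mn p) xs y"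

lemma evaluates_deterministic:
  "evaluates p xs y \<Longrightarrow> evaluates p xs z \<Longrightarrow> y = z"
proof (induction arbitrary: z rule: evaluates.induct)
  case (Comp xs qs zs p y)
  from Comp.prems obtain zs' where zs': "list_all2 (\<lambda>q z. evaluates q xs z) qs zs'" "evaluates p zs' z"
    by (elim evaluates_CompE) blast
  have "zs = zs'"
    using Comp(1) zs'(1) by (auto simp: list_all2_conv_all_nth intro!: nth_equalityI)
  then show ?case using Comp.IH zs'(2) by blast
next
  case (Prec_Suc p q n xs z' y)
  from Prec_Suc.prems obtain w where "evaluates (Prec p q) (n # xs) w" "evaluates q (n # w # xs) z"
    by (elim evaluates_Prec_SucE) blast
  then show ?case using Prec_Suc.IH by blast
next
  case (Mn p n xs)
  from Mn.prems have z: "evaluates p (z # xs) 0" "\<forall>m < z. \<exists>k > 0. evaluates p (m # xs) k"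
    by (auto elim: evaluates_MnE)
  have "\<not> z < n"
  proof
    assume "z < n"
    with Mn obtain k where "k > 0" "\<forall>w. evaluates p (z # xs) w \<longrightarrow> k = w"
      by blast
    with z(1) show False by blast
  qed
  moreover have "\<not> n < z"
  proof
    assume "n < z"
    with z(2) obtain k where "k > 0" "evaluates p (n # xs) k" by blast
    with Mn.IH(1) show False by blast
  qed
  ultimately show ?case by simp
qed (blast elim: evaluates_ZeroE evaluates_SuccE evaluates_ProjE evaluates_Prec_0E)+

text \<open>
  A single program computes \<open>h x\<close> from the code of \<open>x\<close> for every input \<open>x\<close> in \<open>D\<close>; nothing is
  demanded outside of \<open>D\<close>.
\<close>

definition computable_on :: "'a set \<Rightarrow> ('a \<Rightarrow> nat) \<Rightarrow> ('a \<Rightarrow> nat) \<Rightarrow> bool" where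
  "computable_on D code h \<longleftrightarrow> (\<exists>p. \<forall>x \<in> D. evaluates p [code x] (h x))"

definition computable_set :: "nat set \<Rightarrow> bool" where
  "computable_set A \<longleftrightarrow> computable_on UNIV (\<lambda>n. n) (\<lambda>n. of_bool (n \<in> A))"

text \<open>
  Goedel numbering of formulas, relative to numberings \<open>cf\<close> and \<open>cp\<close> of the function and
  predicate symbols.
\<close>

fun trm_code :: "('f \<Rightarrow> nat) \<Rightarrow> 'f trm \<Rightarrow> nat" where
  "trm_code cf (Var x) = prod_encode (0, x)"
| "trm_code cf (App f ts) =
     prod_encode (1, prod_encode (cf f, list_encode (map (trm_code cf) ts)))"

fun form_code :: "('f \<Rightarrow> nat) \<Rightarrow> ('p \<Rightarrow> nat) \<Rightarrow> ('f, 'p) form \<Rightarrow> nat" where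
  "form_code cf cp (Eq s t) = prod_encode (0, prod_encode (trm_code cf s, trm_code cf t))"
| "form_code cf cp (Pred p ts) =
     prod_encode (1, prod_encode (cp p, list_encode (map (trm_code cf) ts)))"
| "form_code cf cp (Neg \<phi>) = prod_encode (2, form_code cf cp \<phi>)"
| "form_code cf cp (Conj \<phi> \<psi>) = prod_encode (3, prod_encode (form_code cf cp \<phi>, form_code cf cp \<psi>))"
| "form_code cf cp (Disj \<phi> \<psi>) = prod_encode (4, prod_encode (form_code cf cp \<phi>, form_code cf cp \<psi>))"
| "form_code cf cp (Imp \<phi> \<psi>) = prod_encode (5, prod_encode (form_code cf cp \<phi>, form_code cf cp \<psi>))"
| "form_code cf cp (All x \<phi>) = prod_encode (6, prod_encode (x, form_code cf cp \<phi>))"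
| "form_code cf cp (Ex x \<phi>) = prod_encode (7, prod_encode (x, form_code cf cp \<phi>))"

lemma trm_code_inject:
  assumes "inj_on cf (funs \<Sigma>)"
  shows "trm_over \<Sigma> s \<Longrightarrow> trm_over \<Sigma> t \<Longrightarrow> trm_code cf s = trm_code cf t \<Longrightarrow> s = t"
proof (induction s arbitrary: t)
  case (Var x)
  then show ?case by (cases t) auto
next
  case (App f ss)
  then obtain g ts where t: "t = App g ts"
    by (cases t) auto
  have fg: "f = g"
    using App.prems assms by (auto simp: t dest: inj_onD)
  have *: "map (trm_code cf) ss = map (trm_code cf) ts"
    using App.prems by (simp add: t list_encode_eq)
  have "ss = ts"
  proof (rule nth_equalityI)
    show len: "length ss = length ts" using * by (rule map_eq_imp_length_eq)
    fix i assume i: "i < length ss"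
    then have "trm_code cf (ss ! i) = trm_code cf (ts ! i)"
      using arg_cong[OF *, of "\<lambda>xs. xs ! i"] len by simp
    then show "ss ! i = ts ! i"
      using App i len by (auto simp: t)
  qed
  with fg show ?case by (simp add: t)
qed

lemma form_code_inject:
  assumes "inj_on cf (funs \<Sigma>)" "inj_on cp (preds \<Sigma>)"
  shows "form_over \<Sigma> \<phi> \<Longrightarrow> form_over \<Sigma> \<psi> \<Longrightarrow> form_code cf cp \<phi> = form_code cf cp \<psi> \<Longrightarrow> \<phi> = \<psi>"
proof (induction \<phi> arbitrary: \<psi>)
  case (Eq s t)
  then show ?case using trm_code_inject[OF assms(1)] by (cases \<psi>) auto
next
  case (Pred p ts)
  then obtain q us where \<psi>: "\<psi> = Pred q us"
    by (cases \<psi>) auto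
  have "p = q"
    using Pred.prems assms(2) by (auto simp: \<psi> dest: inj_onD)
  moreover have "inj_on (trm_code cf) (set ts \<union> set us)"
    using Pred.prems trm_code_inject[OF assms(1)] by (auto simp: \<psi> intro!: inj_onI)
  moreover have "map (trm_code cf) ts = map (trm_code cf) us"
    using Pred.prems by (simp add: \<psi> list_encode_eq)
  ultimately show ?case
    unfolding \<psi> by (blast dest: map_inj_on)
qed (case_tac \<psi>; auto)+


section \<open>Gentle theories\<close>

definition max0 :: "nat set \<Rightarrow> nat" where
  "max0 A = (if A = {} then 0 else Max A)"

text \<open>
  The first condition asks each single spectrum to be a computable set of numbers. If membership
  of \<open>n\<close> in \<open>Spec T \<phi>\<close> can be decided by one program from both \<open>\<phi>\<close> and \<open>n\<close>, then it holds; see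
  \<open>computable_set_if_uniform\<close> below. The algorithms in the other conditions are uniform in \<open>\<phi>\<close>.
\<close>

definition gentle ::
    "('f \<Rightarrow> nat) \<Rightarrow> ('p \<Rightarrow> nat) \<Rightarrow> ('f, 'p) signature \<Rightarrow> ('f, 'p, 'u :: infinite) interp set \<Rightarrow> bool"
where
  "gentle cf cp \<Sigma> T \<longleftrightarrow>
     (\<forall>\<phi> \<in> qf_forms \<Sigma>. computable_set (Spec T \<phi>)) \<and>
     (\<forall>\<phi> \<in> qf_forms \<Sigma>. finite (- Spec T \<phi>) \<or> finite (Spec T \<phi>)) \<and>
     computable_on (qf_forms \<Sigma>) (form_code cf cp) (\<lambda>\<phi>. of_bool (finite (Spec T \<phi>))) \<and>
     computable_on {\<phi> \<in> qf_forms \<Sigma>. finite (Spec T \<phi>)} (form_code cf cp)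
       (\<lambda>\<phi>. max0 (Spec T \<phi>)) \<and>
     computable_on {\<phi> \<in> qf_forms \<Sigma>. infinite (Spec T \<phi>)} (form_code cf cp)
       (\<lambda>\<phi>. max0 (- Spec T \<phi>))"

lemma computable_set_if_uniform:
  assumes "\<forall>n. evaluates p [c, n] (of_bool (n \<in> A))"
  shows "computable_set A"
proof -
  have "\<exists>q. \<forall>xs. evaluates q xs c"
  proof (induction c)
    case 0
    then show ?case using evaluates.Zero by blast
  next
    case (Suc c)
    then obtain q where "\<forall>xs. evaluates q xs c" by blast
    then have "\<forall>xs. evaluates (Comp Succ [q]) xs (Suc c)"
      by (auto intro!: evaluates.Comp[where zs = "[c]"] evaluates.Succ)
    then show ?case by blast
  qed
  then obtain q where q: "\<forall>xs. evaluates q xs c" by blast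
  have id: "evaluates (Proj 0) [n] n" for n
    using evaluates.Proj[of 0 "[n]"] by simp
  have "evaluates (Comp p [q, Proj 0]) [n] (of_bool (n \<in> A))" for n
    by (rule evaluates.Comp[where zs = "[c, n]"]) (use q id assms in auto)
  then show ?thesis unfolding computable_set_def computable_on_def by blast
qed

end

theory Submission
  imports Defs
begin

text \<open>Gentleness forces every spectrum of a quantifier-free formula to be finite or co-finite.
  A finite set has a bounded counting function, so dividing by n sends it to 0
  (\<open>density_finite\<close>). Within {1..n} the counts of a set and of its complement add up to
  n, so a co-finite set has density 1 (\<open>density_cofinite\<close>).\<close>

lemma density_finite:
  fixes A :: "nat set"
  assumes "finite A"
  shows "(\<lambda>n. real (card (A \<inter> {1..n})) / real n) \<longlonglongrightarrow> 0"
\<comment> \<open>The ratio is squeezed between the constant 0 and \<open>card A\<close> / n; the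
  final \<open>simp\<close> settles the lower bound.\<close>
proof (rule tendsto_sandwich[OF _ _ tendsto_const])
  show "(\<lambda>n. real (card A) / real n) \<longlonglongrightarrow> 0"
    by (rule lim_const_over_n)
  show "\<forall>\<^sub>F n in sequentially. real (card (A \<inter> {1..n})) / real n \<le> real (card A) / real n"
    using assms by (auto intro!: always_eventually divide_right_mono card_mono)
qed simp

lemma density_cofinite:
  fixes A :: "nat set"
  assumes "finite (- A)"
  shows "(\<lambda>n. real (card (A \<inter> {1..n})) / real n) \<longlonglongrightarrow> 1"
\<comment> \<open>The two ratios agree only eventually: at n = 0, division by zero yields 0, so one
  side is 1 and the other 0.\<close>
proof (rule Lim_transform_eventually)
  show "(\<lambda>n. 1 - real (card (- A \<inter> {1..n})) / real n) \<longlonglongrightarrow> 1"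
    using tendsto_diff[OF tendsto_const density_finite[OF assms]] by simp
  have "1 - real (card (- A \<inter> {1..n})) / real n = real (card (A \<inter> {1..n})) / real n"
    if "n > 0" for n
  proof -
    have "card (A \<inter> {1..n}) + card (- A \<inter> {1..n}) = card ((A \<inter> {1..n}) \<union> (- A \<inter> {1..n}))"
      by (rule card_Un_disjoint[symmetric]) auto
    also have "(A \<inter> {1..n}) \<union> (- A \<inter> {1..n}) = {1..n}"
      by auto
    finally have "real (card (A \<inter> {1..n})) + real (card (- A \<inter> {1..n})) = real n"
      by (simp flip: of_nat_add)
    with that show ?thesis
      by (simp add: field_simps)
  qed
  then show "\<forall>\<^sub>F n in sequentially.
      1 - real (card (- A \<inter> {1..n})) / real n = real (card (A \<inter> {1..n})) / real n"
    using eventually_gt_at_top[of 0] by (rule eventually_mono[rotated])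
qed

theorem theorem8:
  fixes \<Sigma> :: "('f, 'p) signature"
    and cf :: "'f \<Rightarrow> nat" and cp :: "'p \<Rightarrow> nat"
    and T :: "('f, 'p, 'u :: infinite) interp set"
  assumes "inj_on cf (funs \<Sigma>)" and "inj_on cp (preds \<Sigma>)"
    and "is_theory \<Sigma> T"
    and "gentle cf cp \<Sigma> T"
  shows "\<forall>\<phi> \<in> qf_forms \<Sigma>. satisfiable_in T \<phi> \<longrightarrow>
           mu_well_defined T \<phi> \<and> (mu T \<phi> = 0 \<or> mu T \<phi> = 1)"
proof (intro ballI impI)
  fix \<phi> assume "\<phi> \<in> qf_forms \<Sigma>"
  \<comment> \<open>Domains are non-empty, so 0 always lies in \<open>- Spec T \<phi>\<close>; this
    single point affects neither finiteness nor the ratio, which counts from 1.\<close>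
  with assms(4) have "finite (- Spec T \<phi>) \<or> finite (Spec T \<phi>)"
    by (simp add: gentle_def)
  then have "Spec_ratio T \<phi> \<longlonglongrightarrow> 0 \<or> Spec_ratio T \<phi> \<longlonglongrightarrow> 1"
    unfolding Spec_ratio_def[abs_def] using density_finite density_cofinite by blast
  then show "mu_well_defined T \<phi> \<and> (mu T \<phi> = 0 \<or> mu T \<phi> = 1)"
    \<comment> \<open>An explicit limit yields both convergence and, by uniqueness of limits, the
      value of \<open>lim\<close>.\<close>
    unfolding mu_well_defined_def mu_def by (auto intro: convergentI limI)
qed

end
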